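(* Let $G$ be a connected simple graph with $n\ge 2$ vertices and $m$ edges, with maximum vertex degree $\Delta(G)$ and minimum vertex degree $\delta(G)$, and let $q(G)$ be the largest eigenvalue of its signless Laplacian matrix. Then $$q(G)\le \frac{2m}{n}+\frac{\sqrt{m(n-1)\big(2\Delta(G)\delta(G)(n-2m)+m(\Delta(G)+\delta(G))^2\big)}}{n\sqrt{\Delta(G)\delta(G)}},$$ with equality if and only if $G\cong K_n$.
   Context: The signless Laplacian matrix of $G$ is $Q(G)=D(G)+A(G)$, where $A(G)$ is the adjacency matrix and $D(G)$ the diagonal matrix of vertex degrees. $K_n$ is the complete graph on $n$ vertices. *)

theory Defs
  imports "Graph_Theory.Graph_Theory" "Jordan_Normal_Form.Spectral_Radius"
begin

text \<open>
  Finite simple graphs are the \<^locale>\<open>graph\<close>s of \<^theory>\<open>Graph_Theory.Digraph\<close>: finite, loopfree,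
  symmetric digraphs without parallel arcs. An undirected edge \<open>{u, v}\<close> is thus represented
  by the two arcs \<open>u \<rightarrow> v\<close> and \<open>v \<rightarrow> u\<close>. Hence the edges are the unordered end pairs of arcs (there
  are half as many edges as arcs), and the degree of a vertex is its out-degree.
\<close>

definition edge_set :: "('a, 'b) pre_digraph \<Rightarrow> 'a set set" where
  "edge_set G = (\<lambda>e. {tail G e, head G e}) ` arcs G"

definition max_degree :: "('a, 'b) pre_digraph \<Rightarrow> nat" where
  "max_degree G = Max (out_degree G ` verts G)"

definition min_degree :: "('a, 'b) pre_digraph \<Rightarrow> nat" where
  "min_degree G = Min (out_degree G ` verts G)"

definition complete_graph :: "nat \<Rightarrow> nat pair_pre_digraph" where
  "complete_graph n =
    \<lparr>pverts = {..<n}, parcs = {(i, j). i < n \<and> j < n \<and> i \<noteq> j}\<rparr>"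

lemma complete_digraph_complete_graph:
  "complete_digraph n (with_proj (complete_graph n))"
proof -
  have "finite {(i, j). i < n \<and> j < n \<and> i \<noteq> j}"
    by (rule finite_subset[of _ "{..<n} \<times> {..<n}"]) auto
  then show ?thesis
    unfolding complete_digraph_pair_def by (auto simp: complete_graph_def)
qed

text \<open>
  The matrices of a graph are indexed by \<open>0, \<dots>, n - 1\<close>, so they are taken with respect to a
  list \<open>vs\<close> that enumerates the vertices without repetition.
\<close>

definition adjacency_mat :: "'a list \<Rightarrow> ('a, 'b) pre_digraph \<Rightarrow> real mat" where
  "adjacency_mat vs G =
    mat (length vs) (length vs) (\<lambda>(i, j). if (vs ! i, vs ! j) \<in> arcs_ends G then 1 else 0)"

definition degree_mat :: "'a list \<Rightarrow> ('a, 'b) pre_digraph \<Rightarrow> real mat" where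
  "degree_mat vs G =
    mat (length vs) (length vs) (\<lambda>(i, j). if i = j then real (out_degree G (vs ! i)) else 0)"

definition signless_laplacian :: "'a list \<Rightarrow> ('a, 'b) pre_digraph \<Rightarrow> real mat" where
  "signless_laplacian vs G = degree_mat vs G + adjacency_mat vs G"

text \<open>
  The spectrum below is the set of real eigenvalues; it is only used for symmetric real matrices of
  positive dimension, all of whose eigenvalues are real, so that it is finite and nonempty.
\<close>

definition largest_eigenvalue :: "real mat \<Rightarrow> real" where
  "largest_eigenvalue M = Max (spectrum M)"

end

theory Submission
  imports Defs
begin

text \<open>
  Let \<open>Q\<close> be the signless Laplacian, so \<open>tr Q = 2 m\<close> and \<open>tr Q\<^sup>2 = \<Sum>v. (d v)\<^sup>2 + 2 m\<close>. Every
  eigenvalue \<open>q\<close> satisfies \<open>(n q - tr Q)\<^sup>2 \<le> (n - 1) (n tr Q\<^sup>2 - (tr Q)\<^sup>2)\<close>, and the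
  Diaz--Metcalf inequality gives \<open>n \<Delta> \<delta> (\<Sum>v. (d v)\<^sup>2) \<le> m\<^sup>2 (\<Delta> + \<delta>)\<^sup>2\<close>. In the case of
  equality \<open>Q = a I + b x x\<^sup>T\<close> for an eigenvector \<open>x\<close>. As every vertex has a neighbour,
  \<open>b\<close> and all entries of \<open>x\<close> are nonzero, so all off-diagonal entries of \<open>Q\<close> are nonzero and the
  graph is complete.
\<close>

section \<open>Real symmetric matrices\<close>

text \<open>For a complex eigenvector \<open>v\<close>, the Hermitian form \<open>S\<close> of
  \<open>v\<close> equals \<open>k\<close> times the squared norm of \<open>v\<close>. Conjugating
  \<open>S\<close> only swaps its two indices, so symmetry of \<open>A\<close> makes
  \<open>S\<close> real; the norm is nonzero, hence \<open>k\<close> is real too.\<close>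

lemma symmetric_real_mat_complex_eigenvalue_real:
  fixes A :: "real mat" and k :: complex
  assumes A: "A \<in> carrier_mat n n"
    and sym: "\<And>i j. i < n \<Longrightarrow> j < n \<Longrightarrow> A $$ (i, j) = A $$ (j, i)"
    and k: "eigenvalue (map_mat complex_of_real A) k"
  shows "k \<in> \<real>"
proof -
  from k obtain v where v: "v \<in> carrier_vec n" "v \<noteq> 0\<^sub>v n"
    and ev: "map_mat complex_of_real A *\<^sub>v v = k \<cdot>\<^sub>v v"
    using A by (auto simp: eigenvalue_def eigenvector_def)
  have row: "(\<Sum>j<n. complex_of_real (A $$ (i, j)) * v $ j) = k * v $ i" if "i < n" for i
    using arg_cong[OF ev, of "\<lambda>w. w $ i"] that A v(1)
    by (simp add: scalar_prod_def lessThan_atLeast0)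
  define S where "S = (\<Sum>i<n. \<Sum>j<n. complex_of_real (A $$ (i, j)) * (cnj (v $ i) * v $ j))"
  define s where "s = (\<Sum>i<n. (cmod (v $ i))\<^sup>2)"
  have "S = (\<Sum>i<n. cnj (v $ i) * (\<Sum>j<n. complex_of_real (A $$ (i, j)) * v $ j))"
    unfolding S_def by (simp add: sum_distrib_left algebra_simps)
  also have "\<dots> = (\<Sum>i<n. k * complex_of_real ((cmod (v $ i))\<^sup>2))"
    by (intro sum.cong refl) (simp add: row, simp add: mult_ac flip: complex_norm_square)
  also have "\<dots> = k * complex_of_real s"
    by (simp add: s_def sum_distrib_left)
  finally have S: "S = k * complex_of_real s" .
  have "cnj S = (\<Sum>i<n. \<Sum>j<n. complex_of_real (A $$ (j, i)) * (cnj (v $ j) * v $ i))"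
    unfolding S_def by (simp add: sym mult_ac)
  also have "\<dots> = S"
    unfolding S_def by (rule sum.swap)
  finally have "cnj S = S" .
  obtain i where i: "i < n" "v $ i \<noteq> 0"
    using v by (metis carrier_vecD eq_vecI index_zero_vec)
  then have "0 < (cmod (v $ i))\<^sup>2" by simp
  also have "\<dots> \<le> s"
    unfolding s_def using i(1) by (intro member_le_sum) auto
  finally have "s \<noteq> 0" by simp
  with \<open>cnj S = S\<close> have "cnj k = k"
    unfolding S by simp
  then show ?thesis
    by (simp add: Reals_cnj_iff)
qed

text \<open>Over the complex numbers an eigenvalue exists; it is real by the previous lemma, and the
  characteristic polynomial has real coefficients, so it is also a root over the reals. This makes
  the \<open>Max\<close> in \<open>largest_eigenvalue\<close> meaningful.\<close>

lemma symmetric_real_mat_spectrum_nonempty: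
  fixes A :: "real mat"
  assumes A: "A \<in> carrier_mat n n" and "n > 0"
    and sym: "\<And>i j. i < n \<Longrightarrow> j < n \<Longrightarrow> A $$ (i, j) = A $$ (j, i)"
  shows "spectrum A \<noteq> {}"
proof -
  have C: "map_mat complex_of_real A \<in> carrier_mat n n"
    using A by simp
  obtain k where k: "eigenvalue (map_mat complex_of_real A) k"
    using spectrum_non_empty[OF C \<open>n > 0\<close>] by (auto simp: spectrum_def)
  then obtain r where r: "k = complex_of_real r"
    using symmetric_real_mat_complex_eigenvalue_real[OF A sym] by (auto elim: Reals_cases)
  have "poly (map_poly complex_of_real (char_poly A)) (complex_of_real r) = 0"
    using k unfolding r eigenvalue_root_char_poly[OF C] of_real_hom.char_poly_hom[OF A] .
  then have "r \<in> spectrum A"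
    by (simp add: spectrum_root_char_poly[OF A])
  then show ?thesis by auto
qed

text \<open>
  For the orthogonal projection \<open>P\<close> onto the eigenvector, \<open>A - a I - (k - a) P\<close> with
  \<open>a = (tr A - k) / (n - 1)\<close> has nonnegative squared Frobenius norm.
\<close>

lemma eigenvalue_trace_bound:
  fixes A :: "real mat"
  assumes A: "A \<in> carrier_mat n n" and n: "n \<ge> 2"
    and ev: "eigenvector A v k"
  defines "T \<equiv> \<Sum>i<n. A $$ (i, i)" and "F \<equiv> \<Sum>i<n. \<Sum>j<n. (A $$ (i, j))\<^sup>2"
  shows "(real n * k - T)\<^sup>2 \<le> (real n - 1) * (real n * F - T\<^sup>2)" (is ?le)
    and "(real n * k - T)\<^sup>2 = (real n - 1) * (real n * F - T\<^sup>2) \<Longrightarrow>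
      \<exists>a b. \<forall>i<n. \<forall>j<n. A $$ (i, j) = (if i = j then a else 0) + b * (v $ i * v $ j)"
proof -
  from ev have v: "v \<in> carrier_vec n" "v \<noteq> 0\<^sub>v n" and ev': "A *\<^sub>v v = k \<cdot>\<^sub>v v"
    using A by (auto simp: eigenvector_def)
  have row: "(\<Sum>j<n. A $$ (i, j) * v $ j) = k * v $ i" if "i < n" for i
    using arg_cong[OF ev', of "\<lambda>w. w $ i"] that A v(1)
    by (simp add: scalar_prod_def lessThan_atLeast0)
  define s where "s = (\<Sum>i<n. (v $ i)\<^sup>2)"
  obtain i where i: "i < n" "v $ i \<noteq> 0"
    using v by (metis carrier_vecD eq_vecI index_zero_vec)
  then have "0 < (v $ i)\<^sup>2" by simp
  also have "\<dots> \<le> s"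
    unfolding s_def using i(1) by (intro member_le_sum) auto
  finally have s: "s > 0" .
  define P where "P i j = v $ i * v $ j / s" for i j
  define I where "I i j = (if i = j then 1 else 0 :: real)" for i j :: nat
  have trP: "(\<Sum>i<n. P i i) = 1"
    using s by (simp add: P_def s_def power2_eq_square flip: sum_divide_distrib)
  \<comment> \<open>As \<open>P\<close> has rank one, its squared Frobenius norm factors into the
    square of its trace.\<close>
  have PP: "(\<Sum>i<n. \<Sum>j<n. (P i j)\<^sup>2) = 1"
  proof -
    have "(\<Sum>i<n. \<Sum>j<n. (P i j)\<^sup>2) = (\<Sum>i<n. P i i) * (\<Sum>j<n. P j j)"
      unfolding sum_product by (simp add: P_def power2_eq_square mult_ac)
    then show ?thesis by (simp add: trP)
  qed
  \<comment> \<open>The Frobenius inner product is evaluated row by row: the eigenvector equation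
    turns row \<open>i\<close> into \<open>k * P i i\<close>.\<close>
  have AP: "(\<Sum>i<n. \<Sum>j<n. A $$ (i, j) * P i j) = k"
  proof -
    have "(\<Sum>j<n. A $$ (i, j) * P i j) = k * P i i" if "i < n" for i
    proof -
      have "(\<Sum>j<n. A $$ (i, j) * P i j) = (\<Sum>j<n. A $$ (i, j) * v $ j) * (v $ i / s)"
        by (simp add: P_def sum_distrib_left sum_distrib_right sum_divide_distrib mult_ac)
      then show ?thesis by (simp add: row that P_def)
    qed
    then have "(\<Sum>i<n. \<Sum>j<n. A $$ (i, j) * P i j) = k * (\<Sum>i<n. P i i)"
      by (simp add: sum_distrib_left)
    then show ?thesis by (simp add: trP)
  qed
  have I: "(\<Sum>i<n. \<Sum>j<n. I i j * f i j) = (\<Sum>i<n. f i i)" for f :: "nat \<Rightarrow> nat \<Rightarrow> real"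
    by (intro sum.cong refl) (simp add: I_def if_distrib[of "\<lambda>x. x * _"] cong: if_cong)
  \<comment> \<open>For symmetric \<open>A\<close>, \<open>a\<close> is the mean of the other
    \<open>n - 1\<close> eigenvalues and \<open>N\<close> below is the sum of their squared
    deviations from it. The choice of \<open>b\<close> gives \<open>a I + b P\<close> the eigenvalue
    \<open>k\<close> at \<open>v\<close>.\<close>
  define a where "a = (T - k) / (real n - 1)"
  define b where "b = k - a"
  define N where "N = (\<Sum>i<n. \<Sum>j<n. (A $$ (i, j) - a * I i j - b * P i j)\<^sup>2)"
  have "N = (\<Sum>i<n. \<Sum>j<n. (A $$ (i, j))\<^sup>2 + a\<^sup>2 * (I i j * I i j) + b\<^sup>2 * (P i j)\<^sup>2
      - 2 * a * (I i j * A $$ (i, j)) - 2 * b * (A $$ (i, j) * P i j) + 2 * a * b * (I i j * P i j))"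
    unfolding N_def by (intro sum.cong refl) (simp add: power2_eq_square algebra_simps)
  also have "\<dots> = F + a\<^sup>2 * n + b\<^sup>2 - 2 * a * T - 2 * b * k + 2 * a * b"
    by (simp only: sum.distrib sum_subtractf flip: sum_distrib_left)
      (simp only: I PP AP trP F_def T_def, simp add: I_def)
  finally have N: "N = F + a\<^sup>2 * n + b\<^sup>2 - 2 * a * T - 2 * b * k + 2 * a * b" .
  have a: "a * (real n - 1) = T - k"
    using n by (simp add: a_def)
  \<comment> \<open>The factor \<open>n (n - 1)\<close> clears the denominator of \<open>a\<close>,
    so that \<open>N\<close> measures exactly the gap in the claimed inequality.\<close>
  have "real n * (real n - 1) * N = (real n - 1) * (real n * F - T\<^sup>2) - (real n * k - T)\<^sup>2"
  proof -
    have "N = F - k\<^sup>2 + a * (a * (real n - 1)) - 2 * a * (T - k)"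
      unfolding N b_def by (simp add: power2_eq_square algebra_simps)
    also have "\<dots> = F - k\<^sup>2 - a * (T - k)"
      unfolding a by (simp add: algebra_simps)
    finally have "N = F - k\<^sup>2 - a * (T - k)" .
    then have "real n * (real n - 1) * N
        = real n * ((real n - 1) * (F - k\<^sup>2) - (a * (real n - 1)) * (T - k))"
      by (simp only:) (simp add: algebra_simps)
    then show ?thesis
      unfolding a by (simp add: power2_eq_square algebra_simps)
  qed
  moreover have "N \<ge> 0"
    unfolding N_def by (intro sum_nonneg) simp
  then have "real n * (real n - 1) * N \<ge> 0"
    using n by simp
  ultimately show ?le by linarith
  assume "(real n * k - T)\<^sup>2 = (real n - 1) * (real n * F - T\<^sup>2)"
  \<comment> \<open>A vanishing sum of squares forces every entry of \<open>A - a I - b P\<close> to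
    be zero. The normalisation \<open>s\<close> of \<open>P\<close> is then absorbed into the
    coefficient \<open>b / s\<close>.\<close>
  with \<open>real n * (real n - 1) * N = _\<close> n have "N = 0" by auto
  then have "A $$ (i, j) - a * I i j - b * P i j = 0" if "i < n" "j < n" for i j
    using that unfolding N_def
    by (simp add: sum_nonneg_eq_0_iff sum_nonneg)
  then have "\<forall>i<n. \<forall>j<n. A $$ (i, j) = (if i = j then a else 0) + b / s * (v $ i * v $ j)"
    by (fastforce simp: I_def P_def)
  then show "\<exists>a b. \<forall>i<n. \<forall>j<n. A $$ (i, j) = (if i = j then a else 0) + b * (v $ i * v $ j)"
    by blast
qed

section \<open>Edges and degrees\<close>

text \<open>Every fibre of the map from arcs to end pairs consists of an arc and its reverse. These
  differ because there are no loops, and there is no third arc because there are no parallel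
  ones.\<close>

lemma (in graph) card_arcs_eq_twice_card_edge_set: "card (arcs G) = 2 * card (edge_set G)"
proof -
  let ?f = "\<lambda>e. {tail G e, head G e}"
  have "card {a \<in> arcs G. ?f a = e} = 2" if "e \<in> edge_set G" for e
  proof -
    from that obtain a where a: "a \<in> arcs G" "e = ?f a"
      by (auto simp: edge_set_def)
    from a(1) obtain a' where a': "a' \<in> arcs G" "tail G a' = head G a" "head G a' = tail G a"
      using sym_arcs unfolding symmetric_conv by metis
    have "{a \<in> arcs G. ?f a = e} = {a, a'}"
      using a a' by (auto simp: doubleton_eq_iff arc_to_ends_def intro: no_multi_arcs)
    moreover have "a \<noteq> a'"
      using a a' no_loops by metis
    ultimately show ?thesis by simp
  qed
  then have "(\<Sum>e\<in>edge_set G. card {a \<in> arcs G. ?f a = e}) = 2 * card (edge_set G)"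
    by simp
  moreover have "card (arcs G) = (\<Sum>e\<in>edge_set G. card {a \<in> arcs G. ?f a = e})"
    using sum.image_gen[of "arcs G" "\<lambda>_. 1::nat" ?f] by (simp add: edge_set_def)
  ultimately show ?thesis by simp
qed

lemma (in nomulti_digraph) out_degree_eq_card_neighbours:
  "out_degree G u = card {v. (u, v) \<in> arcs_ends G}"
proof -
  have "inj_on (head G) (out_arcs G u)"
    by (auto intro!: inj_onI no_multi_arcs simp: arc_to_ends_def)
  moreover have "head G ` out_arcs G u = {v. (u, v) \<in> arcs_ends G}"
    by (auto simp: arcs_ends_conv)
  ultimately show ?thesis
    unfolding out_degree_def by (metis card_image)
qed

lemma (in fin_digraph) sum_out_degree: "(\<Sum>v\<in>verts G. out_degree G v) = card (arcs G)"
proof -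
  have "tail G ` arcs G \<subseteq> verts G" by auto
  then have "(\<Sum>v\<in>verts G. card {a \<in> arcs G. tail G a = v}) = card (arcs G)"
    using sum.group[of "arcs G" "verts G" "tail G" "\<lambda>_. 1::nat"] by simp
  then show ?thesis by (simp add: out_degree_def out_arcs_def)
qed

lemma (in graph) connected_imp_has_neighbour:
  assumes "connected G" "card (verts G) \<ge> 2" "u \<in> verts G"
  obtains v where "(u, v) \<in> arcs_ends G"
proof -
  have "verts G \<noteq> {u}" using assms(2) by auto
  then obtain w where "w \<in> verts G" "w \<noteq> u" using assms(3) by auto
  moreover have "strongly_connected G"
    using symmetric_connected_imp_strongly_connected[OF sym_arcs assms(1)] .
  ultimately have "u \<rightarrow>\<^sup>*\<^bsub>G\<^esub> w" using assms(3) by auto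
  \<comment> \<open>The first arc of a path from \<open>u\<close> to the different vertex
    \<open>w\<close> leads to a neighbour.\<close>
  then show thesis
    using \<open>w \<noteq> u\<close> that by (cases rule: converse_reachable_cases) auto
qed

section \<open>Recognising complete graphs\<close>

text \<open>Replaces the existence of an isomorphism by a condition on \<open>arcs_ends G\<close>,
  which can be read off the entries of the matrix.\<close>

lemma (in graph) digraph_iso_complete_graph_iff:
  "digraph_iso G (with_proj (complete_graph n)) \<longleftrightarrow> complete_digraph n G"
proof
  assume "digraph_iso G (with_proj (complete_graph n))"
  then obtain f where f: "digraph_isomorphism f" "with_proj (complete_graph n) = app_iso f G"
    by (auto simp: digraph_iso_def)
  have "verts (with_proj (complete_graph n)) = {..<n}"
    by (simp add: complete_graph_def)
  then have V: "iso_verts f ` verts G = {..<n}"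
    using f(2) by simp
  have inj: "inj_on (iso_verts f) (verts G)"
    using f(1) by (rule digraph_isomorphism_inj_on_verts)
  have E: "(\<lambda>(u, v). (iso_verts f u, iso_verts f v)) ` arcs_ends G = {(i, j). i < n \<and> j < n \<and> i \<noteq> j}"
    unfolding arcs_ends_app_iso_eq[OF f(1), symmetric] f(2)[symmetric]
    by (auto simp: complete_graph_def arcs_ends_conv)
  have "(u, v) \<in> arcs_ends G" if uv: "u \<in> verts G" "v \<in> verts G" "u \<noteq> v" for u v
  proof -
    have "(iso_verts f u, iso_verts f v) \<in> (\<lambda>(u, v). (iso_verts f u, iso_verts f v)) ` arcs_ends G"
      unfolding E using uv V inj by (auto simp: inj_on_eq_iff)
    then obtain u' v' where uv': "(u', v') \<in> arcs_ends G" "iso_verts f u = iso_verts f u'"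
        "iso_verts f v = iso_verts f v'"
      by auto
    then have "u = u'" "v = v'"
      using uv adj_in_verts[OF uv'(1)] inj by (auto dest: inj_onD)
    with uv'(1) show ?thesis by simp
  qed
  then have E: "arcs_ends G = {(u, v). (u, v) \<in> verts G \<times> verts G \<and> u \<noteq> v}"
    by (auto dest: adj_in_verts adj_not_same)
  have "card (verts G) = n"
    using card_image[OF inj] V by simp
  with E show "complete_digraph n G"
    unfolding complete_digraph_def by (auto intro: graph_axioms)
next
  assume K: "complete_digraph n G"
  then have n: "card (verts G) = n"
    and E: "arcs_ends G = {(u, v). (u, v) \<in> verts G \<times> verts G \<and> u \<noteq> v}"
    by (auto simp: complete_digraph_def)
  obtain h where h: "bij_betw h (verts G) {..<n}"
    using ex_bij_betw_finite_nat[OF finite_verts] n by (auto simp: lessThan_atLeast0)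
  \<comment> \<open>Any numbering \<open>h\<close> of the vertices works. Arcs of
    \<open>complete_graph\<close> are pairs of numbers, so an arc is sent to the numbers of its
    ends; this is injective as there are no parallel arcs.\<close>
  let ?f = "\<lparr>iso_verts = h, iso_arcs = (\<lambda>a. (h (tail G a), h (head G a))),
    iso_head = snd, iso_tail = fst\<rparr>"
  have inj: "inj_on h (verts G)" and img: "h ` verts G = {..<n}"
    using h by (auto simp: bij_betw_def)
  have "digraph_isomorphism ?f"
    unfolding digraph_isomorphism_def
    using inj by (auto intro!: wf_digraph inj_onI no_multi_arcs simp: arc_to_ends_def inj_on_eq_iff)
  moreover have "(\<lambda>a. (h (tail G a), h (head G a))) ` arcs G = {(i, j). i < n \<and> j < n \<and> i \<noteq> j}"
  proof -
    have "(\<lambda>a. (h (tail G a), h (head G a))) ` arcs G = (\<lambda>(u, v). (h u, h v)) ` arcs_ends G"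
      by (auto simp: arcs_ends_conv image_image)
    also have "\<dots> = {(i, j). i \<in> h ` verts G \<and> j \<in> h ` verts G \<and> i \<noteq> j}"
      unfolding E using inj by (auto simp: inj_on_eq_iff image_iff)
    finally show ?thesis by (simp add: img)
  qed
  then have "with_proj (complete_graph n) = app_iso ?f G"
    by (simp add: app_iso_def complete_graph_def img)
  ultimately show "digraph_iso G (with_proj (complete_graph n))"
    by (auto simp: digraph_iso_def)
qed

section \<open>The signless Laplacian\<close>

lemma signless_laplacian_carrier: "signless_laplacian vs G \<in> carrier_mat (length vs) (length vs)"
  by (simp add: signless_laplacian_def degree_mat_def adjacency_mat_def)

lemma signless_laplacian_index:
  "i < length vs \<Longrightarrow> j < length vs \<Longrightarrow> signless_laplacian vs G $$ (i, j) =
    (if i = j then real (out_degree G (vs ! i)) else 0) +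
    (if (vs ! i, vs ! j) \<in> arcs_ends G then 1 else 0)"
  by (simp add: signless_laplacian_def degree_mat_def adjacency_mat_def)

context graph
begin

lemma signless_laplacian_symmetric:
  assumes "i < length vs" "j < length vs"
  shows "signless_laplacian vs G $$ (i, j) = signless_laplacian vs G $$ (j, i)"
  using assms arcs_ends_symmetric[OF sym_arcs] by (auto simp: signless_laplacian_index)

lemma signless_laplacian_diag:
  "i < length vs \<Longrightarrow> signless_laplacian vs G $$ (i, i) = real (out_degree G (vs ! i))"
  using adj_not_same by (auto simp: signless_laplacian_index)

section \<open>Traces of the signless Laplacian and of its square\<close>

lemma sum_nth_verts:
  assumes "distinct vs" "set vs = verts G"
  shows "(\<Sum>i<length vs. f (vs ! i)) = (\<Sum>v\<in>verts G. f v)"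
  using sum.reindex_bij_betw[OF bij_betw_nth[OF assms(1) refl refl], of f] assms(2) by simp

lemma sum_adjacent:
  assumes "distinct vs" "set vs = verts G"
  shows "(\<Sum>j<length vs. if (u, vs ! j) \<in> arcs_ends G then 1 else 0) = real (out_degree G u)"
proof -
  have "{v. (u, v) \<in> arcs_ends G} = verts G \<inter> {v. (u, v) \<in> arcs_ends G}"
    by (auto dest: adj_in_verts)
  then show ?thesis
    unfolding sum_nth_verts[OF assms, of "\<lambda>v. if (u, v) \<in> arcs_ends G then 1 else 0"]
    by (simp add: sum.If_cases out_degree_eq_card_neighbours)
qed

lemma sum_out_degree_eq_twice_card_edge_set:
  "(\<Sum>v\<in>verts G. real (out_degree G v)) = 2 * real (card (edge_set G))"
  using sum_out_degree card_arcs_eq_twice_card_edge_set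
  by (metis of_nat_mult of_nat_numeral of_nat_sum)

lemma signless_laplacian_trace:
  assumes "distinct vs" "set vs = verts G"
  shows "(\<Sum>i<length vs. signless_laplacian vs G $$ (i, i)) = 2 * real (card (edge_set G))"
  using sum_nth_verts[OF assms, of "\<lambda>v. real (out_degree G v)"]
  by (simp add: signless_laplacian_diag sum_out_degree_eq_twice_card_edge_set)

text \<open>A row of a vertex of degree \<open>d\<close> contributes \<open>d^2 + d\<close>: without
  loops the diagonal holds only \<open>d\<close>, and the remaining entries are \<open>d\<close>
  ones and zeros. The linear terms add up to twice the number of edges.\<close>

lemma signless_laplacian_sum_squares:
  assumes "distinct vs" "set vs = verts G"
  shows "(\<Sum>i<length vs. \<Sum>j<length vs. (signless_laplacian vs G $$ (i, j))\<^sup>2) =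
    (\<Sum>v\<in>verts G. (real (out_degree G v))\<^sup>2) + 2 * real (card (edge_set G))"
proof -
  have "(\<Sum>j<length vs. (signless_laplacian vs G $$ (i, j))\<^sup>2) =
      (real (out_degree G (vs ! i)))\<^sup>2 + real (out_degree G (vs ! i))" if "i < length vs" for i
  proof -
    have "(\<Sum>j<length vs. (signless_laplacian vs G $$ (i, j))\<^sup>2) =
        (\<Sum>j<length vs. (if i = j then (real (out_degree G (vs ! i)))\<^sup>2 else 0) +
          (if (vs ! i, vs ! j) \<in> arcs_ends G then 1 else 0))"
      using that adj_not_same by (intro sum.cong refl) (auto simp: signless_laplacian_index)
    then show ?thesis
      using that by (simp add: sum.distrib sum_adjacent[OF assms])
  qed
  then show ?thesis
    using sum_nth_verts[OF assms, of "\<lambda>v. (real (out_degree G v))\<^sup>2 + real (out_degree G v)"]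
    by (simp add: sum.distrib sum_out_degree_eq_twice_card_edge_set)
qed

section \<open>The largest eigenvalue\<close>

lemma signless_laplacian_finite_spectrum: "finite (spectrum (signless_laplacian vs G))"
  using card_finite_spectrum(1)[OF signless_laplacian_carrier] .

lemma largest_eigenvalue_signless_laplacian:
  assumes "vs \<noteq> []"
  shows "eigenvalue (signless_laplacian vs G) (largest_eigenvalue (signless_laplacian vs G))"
  using Max_in[OF signless_laplacian_finite_spectrum
      symmetric_real_mat_spectrum_nonempty[OF signless_laplacian_carrier _
        signless_laplacian_symmetric], of vs] assms
  by (simp add: largest_eigenvalue_def spectrum_def)

section \<open>Extremal degrees and the sum of squared degrees\<close>

lemma min_degree_le: "v \<in> verts G \<Longrightarrow> min_degree G \<le> out_degree G v"
  and max_degree_ge: "v \<in> verts G \<Longrightarrow> out_degree G v \<le> max_degree G"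
  by (auto simp: min_degree_def max_degree_def)

lemma connected_imp_min_degree_pos:
  assumes "connected G" "card (verts G) \<ge> 2"
  shows "min_degree G > 0"
proof -
  have "out_degree G v > 0" if v: "v \<in> verts G" for v
  proof -
    obtain w where "(v, w) \<in> arcs_ends G"
      using connected_imp_has_neighbour[OF assms v] by blast
    then have "out_arcs G v \<noteq> {}" by (auto simp: arcs_ends_conv)
    then show ?thesis by (simp add: out_degree_def card_gt_0_iff finite_out_arcs)
  qed
  moreover have "verts G \<noteq> {}" using assms(2) by auto
  ultimately show ?thesis by (simp add: min_degree_def)
qed

text \<open>
  Diaz--Metcalf: \<open>(d v - \<delta>) (\<Delta> - d v) \<ge> 0\<close> is summed over all vertices; the mixed term is
  then estimated by \<open>(m (\<Delta> + \<delta>) - n \<Delta> \<delta>)\<^sup>2 \<ge> 0\<close>.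
\<close>

lemma sum_squares_out_degree_le:
  fixes \<Delta> \<delta> :: real
  defines "\<Delta> \<equiv> real (max_degree G)" and "\<delta> \<equiv> real (min_degree G)"
    and "m \<equiv> real (card (edge_set G))" and "n \<equiv> real (card (verts G))"
  shows "\<Delta> * \<delta> * n * (\<Sum>v\<in>verts G. (real (out_degree G v))\<^sup>2) \<le> m\<^sup>2 * (\<Delta> + \<delta>)\<^sup>2"
proof -
  define S where "S = (\<Sum>v\<in>verts G. (real (out_degree G v))\<^sup>2)"
  have "0 \<le> (\<Sum>v\<in>verts G. (real (out_degree G v) - \<delta>) * (\<Delta> - real (out_degree G v)))"
    by (intro sum_nonneg mult_nonneg_nonneg) (auto simp: \<Delta>_def \<delta>_def min_degree_le max_degree_ge)
  also have "\<dots> = (\<Sum>v\<in>verts G. (\<Delta> + \<delta>) * real (out_degree G v) - \<Delta> * \<delta> - (real (out_degree G v))\<^sup>2)"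
    by (intro sum.cong refl) (simp add: power2_eq_square algebra_simps)
  also have "\<dots> = (\<Delta> + \<delta>) * (2 * m) - n * (\<Delta> * \<delta>) - S"
    by (simp add: sum_subtractf sum_out_degree_eq_twice_card_edge_set m_def n_def S_def
        flip: sum_distrib_left)
  finally have "S \<le> (\<Delta> + \<delta>) * (2 * m) - n * (\<Delta> * \<delta>)" by simp
  then have "\<Delta> * \<delta> * n * S \<le> \<Delta> * \<delta> * n * ((\<Delta> + \<delta>) * (2 * m) - n * (\<Delta> * \<delta>))"
    by (intro mult_left_mono) (auto simp: \<Delta>_def \<delta>_def n_def)
  also have "\<dots> = m\<^sup>2 * (\<Delta> + \<delta>)\<^sup>2 - (m * (\<Delta> + \<delta>) - n * (\<Delta> * \<delta>))\<^sup>2"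
    by (simp add: power2_eq_square algebra_simps)
  also have "\<dots> \<le> m\<^sup>2 * (\<Delta> + \<delta>)\<^sup>2" by simp
  finally show ?thesis by (simp add: S_def)
qed

section \<open>Equality and complete graphs\<close>

lemma complete_if_signless_laplacian_rank_one:
  assumes "connected G" "card (verts G) \<ge> 2" and vs: "distinct vs" "set vs = verts G"
    and Q: "\<forall>i<length vs. \<forall>j<length vs.
      signless_laplacian vs G $$ (i, j) = (if i = j then a else 0) + b * (v $ i * v $ j)"
  shows "complete_digraph (card (verts G)) G"
proof -
  \<comment> \<open>A single neighbour suffices: it yields an off-diagonal entry 1, to which
    \<open>a\<close> does not contribute, with \<open>b\<close> and \<open>v $ i\<close> among its
    factors.\<close>
  have nz: "b \<noteq> 0 \<and> v $ i \<noteq> 0" if i: "i < length vs" for i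
  proof -
    have "vs ! i \<in> verts G" using i vs(2) nth_mem by blast
    then obtain w where w: "(vs ! i, w) \<in> arcs_ends G"
      using connected_imp_has_neighbour[OF assms(1,2)] by blast
    then obtain j where j: "j < length vs" "w = vs ! j"
      using vs(2) adj_in_verts(2) by (metis in_set_conv_nth)
    have "i \<noteq> j" using w j adj_not_same by auto
    then have "signless_laplacian vs G $$ (i, j) = 1"
      using i j w by (simp add: signless_laplacian_index)
    then have "b * (v $ i * v $ j) = 1"
      using Q i j(1) \<open>i \<noteq> j\<close> by auto
    then show ?thesis by auto
  qed
  have "(x, y) \<in> arcs_ends G" if xy: "x \<in> verts G" "y \<in> verts G" "x \<noteq> y" for x y
  proof -
    obtain i j where ij: "i < length vs" "j < length vs" "x = vs ! i" "y = vs ! j"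
      using xy vs(2) by (metis in_set_conv_nth)
    then have "i \<noteq> j" using xy by auto
    then have "signless_laplacian vs G $$ (i, j) \<noteq> 0"
      using Q nz ij by simp
    then show ?thesis
      using ij \<open>i \<noteq> j\<close> by (simp add: signless_laplacian_index split: if_splits)
  qed
  then show ?thesis
    unfolding complete_digraph_def using graph_axioms
    by (auto dest: adj_in_verts adj_not_same)
qed

lemma complete_out_degree:
  assumes "complete_digraph n G" "v \<in> verts G"
  shows "out_degree G v = n - 1"
proof -
  have "{w. (v, w) \<in> arcs_ends G} = verts G - {v}"
    using assms by (auto simp: complete_digraph_def)
  then show ?thesis
    using assms by (simp add: out_degree_eq_card_neighbours complete_digraph_def)
qed

text \<open>The all-ones vector is an eigenvector, since the degree part and the adjacency part each
  contribute \<open>r\<close> to every row sum. For the complete graph this bounds the largest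
  eigenvalue from below.\<close>

lemma regular_eigenvalue_signless_laplacian:
  assumes "vs \<noteq> []" "distinct vs" "set vs = verts G"
    and "\<And>v. v \<in> verts G \<Longrightarrow> out_degree G v = r"
  shows "eigenvalue (signless_laplacian vs G) (2 * real r)"
  unfolding eigenvalue_def eigenvector_def
proof (intro exI conjI)
  let ?Q = "signless_laplacian vs G" and ?v = "vec (length vs) (\<lambda>_. 1 :: real)"
  have dim: "dim_row ?Q = length vs" "dim_col ?Q = length vs"
    using signless_laplacian_carrier[of vs G] by auto
  show "?v \<in> carrier_vec (dim_row ?Q)" by (simp add: dim)
  show "?v \<noteq> 0\<^sub>v (dim_row ?Q)"
    using assms(1) by (auto simp: dim vec_eq_iff)
  show "?Q *\<^sub>v ?v = (2 * real r) \<cdot>\<^sub>v ?v"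
  proof (rule eq_vecI)
    fix i assume "i < dim_vec ((2 * real r) \<cdot>\<^sub>v ?v)"
    then have i: "i < length vs" by simp
    have "(?Q *\<^sub>v ?v) $ i = (\<Sum>j<length vs. ?Q $$ (i, j))"
      using i by (simp add: dim scalar_prod_def lessThan_atLeast0)
    also have "\<dots> = 2 * real (out_degree G (vs ! i))"
      using i by (simp add: signless_laplacian_index sum.distrib sum_adjacent[OF assms(2,3)])
    also have "out_degree G (vs ! i) = r"
      using i assms(3) nth_mem by (intro assms(4)) blast
    finally show "(?Q *\<^sub>v ?v) $ i = ((2 * real r) \<cdot>\<^sub>v ?v) $ i"
      using i by simp
  qed (simp add: dim)
qed

end

section \<open>The bound and its equality case\<close>

theorem theorem5:
  fixes G :: "('a, 'b) pre_digraph" and vs :: "'a list"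
    and n m \<Delta> \<delta> :: nat and q bound :: real
  assumes "graph G" and "connected G"
    and "n = card (verts G)" and "n \<ge> 2"
    and "m = card (edge_set G)"
    and "\<Delta> = max_degree G" and "\<delta> = min_degree G"
    and "distinct vs" and "set vs = verts G"
    and "q = largest_eigenvalue (signless_laplacian vs G)"
    and "bound = 2 * real m / real n
      + sqrt (real m * (real n - 1)
          * (2 * real \<Delta> * real \<delta> * (real n - 2 * real m) + real m * (real \<Delta> + real \<delta>)\<^sup>2))
        / (real n * sqrt (real \<Delta> * real \<delta>))"
  shows "q \<le> bound \<and> (q = bound \<longleftrightarrow> digraph_iso G (with_proj (complete_graph n)))"
proof -
  interpret graph G by fact
  define Q where "Q = signless_laplacian vs G"
  have len: "length vs = n"
    using assms(3,8,9) distinct_card by fastforce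
  with assms(4) have "vs \<noteq> []" by auto
  have V: "verts G \<noteq> {}" using assms(3,4) by auto
  have \<delta>: "0 < \<delta>"
    using connected_imp_min_degree_pos assms(2,3,4,7) by simp
  obtain v0 where "v0 \<in> verts G" using V by auto
  with \<delta> have \<Delta>: "0 < \<Delta>"
    using min_degree_le max_degree_ge assms(6,7) by fastforce
  define D where "D = real \<Delta> * real \<delta>"
  have D: "D > 0" using \<Delta> \<delta> by (simp add: D_def)
  define S where "S = (\<Sum>v\<in>verts G. (real (out_degree G v))\<^sup>2)"
  \<comment> \<open>\<open>L\<close> is the term \<open>n F - T^2\<close> of the trace bound for
    \<open>Q\<close>. \<open>R\<close> arises from \<open>L\<close> by replacing \<open>n S\<close>
    with its Diaz--Metcalf estimate \<open>m^2 (\<Delta> + \<delta>)^2 / D\<close>.\<close>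
  define R where "R = real m * (2 * D * (real n - 2 * real m) + real m * (real \<Delta> + real \<delta>)\<^sup>2) / D"
  define L where "L = real n * (S + 2 * real m) - (2 * real m)\<^sup>2"
  have "D * R = real m * (2 * D * (real n - 2 * real m) + real m * (real \<Delta> + real \<delta>)\<^sup>2)"
    using D by (simp add: R_def)
  also have "\<dots> = 2 * D * real n * real m - D * (2 * real m)\<^sup>2 + (real m)\<^sup>2 * (real \<Delta> + real \<delta>)\<^sup>2"
    by (simp add: power2_eq_square algebra_simps)
  finally have "D * L \<le> D * R"
    using sum_squares_out_degree_le[folded assms(3,5,6,7), folded D_def S_def]
    by (simp add: L_def algebra_simps)
  then have LR: "L \<le> R" using D by simp
  have bound: "real n * bound - 2 * real m = sqrt ((real n - 1) * R)"
  proof -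
    have "sqrt ((real n - 1) * R) = sqrt (real m * (real n - 1)
          * (2 * D * (real n - 2 * real m) + real m * (real \<Delta> + real \<delta>)\<^sup>2)) / sqrt D"
      by (simp add: R_def mult_ac flip: real_sqrt_divide)
    then show ?thesis
      using assms(4) unfolding assms(11) by (simp add: D_def algebra_simps)
  qed
  have "eigenvalue Q q"
    unfolding Q_def assms(10) using \<open>vs \<noteq> []\<close> by (rule largest_eigenvalue_signless_laplacian)
  then obtain x where x: "eigenvector Q x q" by (auto simp: eigenvalue_def)
  have tr: "(\<Sum>i<n. Q $$ (i, i)) = 2 * real m"
    and F: "(\<Sum>i<n. \<Sum>j<n. (Q $$ (i, j))\<^sup>2) = S + 2 * real m"
    using signless_laplacian_trace[OF assms(8,9)] signless_laplacian_sum_squares[OF assms(8,9)]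
    by (simp_all add: Q_def len S_def assms(5))
  have carrier: "Q \<in> carrier_mat n n"
    using signless_laplacian_carrier[of vs G] by (simp add: Q_def len)
  have qL: "(real n * q - 2 * real m)\<^sup>2 \<le> (real n - 1) * L"
    using eigenvalue_trace_bound(1)[OF carrier assms(4) x] by (simp only: tr F L_def)
  also have LR': "\<dots> \<le> (real n - 1) * R"
    using LR assms(4) by (intro mult_left_mono) auto
  finally have qR: "(real n * q - 2 * real m)\<^sup>2 \<le> (real n - 1) * R" .
  then have "real n * q - 2 * real m \<le> real n * bound - 2 * real m"
    unfolding bound by (rule real_le_rsqrt)
  then have le: "q \<le> bound" using assms(4) by simp
  moreover have "complete_digraph n G" if "q = bound"
  proof -
    \<comment> \<open>\<open>sqrt\<close> is negative at negative arguments, so squaring the formula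
      for \<open>bound\<close> gives back the radicand only once it is known to be
      nonnegative.\<close>
    have "(real n - 1) * R \<ge> 0"
      using qR by (rule order_trans[OF zero_le_power2])
    then have "(real n * q - 2 * real m)\<^sup>2 = (real n - 1) * R"
      using bound that by simp
    \<comment> \<open>The outer terms of the chain formed by \<open>qL\<close> and
      \<open>LR'\<close> agree, so the trace bound is attained.\<close>
    with qL LR' have "(real n * q - 2 * real m)\<^sup>2 = (real n - 1) * L"
      by linarith
    then have "\<exists>a b. \<forall>i<n. \<forall>j<n. Q $$ (i, j) = (if i = j then a else 0) + b * (x $ i * x $ j)"
      using eigenvalue_trace_bound(2)[OF carrier assms(4) x] by (simp only: tr F L_def)
    then show ?thesis
      using complete_if_signless_laplacian_rank_one[OF assms(2) _ assms(8,9)] assms(3,4)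
      by (auto simp: Q_def len)
  qed
  \<comment> \<open>Given \<open>q \<le> bound\<close>, it is enough that \<open>bound\<close>
    evaluates to \<open>2 (n - 1)\<close>, which is an eigenvalue by regularity and hence at most
    the largest one.\<close>
  moreover have "bound \<le> q" if K: "complete_digraph n G"
  proof -
    have deg: "out_degree G v = n - 1" if "v \<in> verts G" for v
      using complete_out_degree[OF K that] .
    then have "out_degree G ` verts G = {n - 1}" using V by auto
    then have dd: "real \<Delta> = real n - 1" "real \<delta> = real n - 1"
      using assms(4,6,7) by (simp_all add: max_degree_def min_degree_def of_nat_diff)
    have m: "2 * real m = real n * (real n - 1)"
      using sum_out_degree_eq_twice_card_edge_set deg assms(3,4,5) by (simp add: of_nat_diff)
    have "R = real n * real n * (real n - 1)"
    proof -
      \<comment> \<open>With equal extremal degrees the terms quadratic in \<open>m\<close> cancel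
        in \<open>R\<close>, leaving \<open>2 m n\<close>.\<close>
      have sq: "(real \<Delta> + real \<delta>)\<^sup>2 = 4 * D"
        by (simp add: D_def dd power2_eq_square algebra_simps)
      have "R = D * (2 * real m * real n) / D"
        unfolding R_def sq by (simp add: power2_eq_square algebra_simps)
      also have "\<dots> = 2 * real m * real n"
        using D by simp
      finally show ?thesis by (simp add: m)
    qed
    then have "sqrt ((real n - 1) * R) = sqrt ((real n * (real n - 1))\<^sup>2)"
      by (simp add: power2_eq_square mult_ac)
    also have "\<dots> = real n * (real n - 1)"
      using assms(4) by (intro real_sqrt_unique) auto
    finally have "real n * bound = real n * (2 * (real n - 1))"
      using bound m by simp
    then have "bound = 2 * real (n - 1)"
      using assms(4) by (simp add: of_nat_diff)
    then have "eigenvalue Q bound"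
      unfolding Q_def
      using regular_eigenvalue_signless_laplacian[OF \<open>vs \<noteq> []\<close> assms(8,9) deg] by simp
    then show ?thesis
      unfolding assms(10) largest_eigenvalue_def
      by (intro Max_ge signless_laplacian_finite_spectrum) (simp add: spectrum_def Q_def)
  qed
  ultimately show ?thesis
    unfolding digraph_iso_complete_graph_iff by auto
qed

end
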